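(* A domain $D\subseteq\{0,1\}^n$ with at least three elements admits an aggregator that is not a generalized dictatorship for $D$ if and only if it is a possibility domain.
   Context: Standing assumption: domains $D\subseteq\{0,1\}^n$ are non-degenerate (projection onto each coordinate is $\{0,1\}$). A $k$-ary aggregator for $D$ ($k\ge2$) is an $n$-tuple $F=(f_1,\ldots,f_n)$ of unanimous functions $f_j:\{0,1\}^k\to\{0,1\}$ such that whenever $x^1,\ldots,x^k\in D$, $F(x^1,\ldots,x^k):=(f_1(x^1_1,\ldots,x^k_1),\ldots,f_n(x^1_n,\ldots,x^k_n))\in D$. It is dictatorial if $f_1=\cdots=f_n={\rm pr}^k_d$ for some $d$; $D$ is a possibility domain if it admits a non-dictatorial aggregator of some arity. An $n$-tuple $F$ of $k$-ary conservative functions is a generalized dictatorship for $D$ if $F(x^1,\ldots,x^k)\in\{x^1,\ldots,x^k\}$ for all $x^1,\ldots,x^k\in D$. *)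

theory Defs
  imports "HOL-Analysis.Finite_Cartesian_Product"
begin

text \<open>
  \<^typ>\<open>bool\<close> plays the role of the two-element set of truth values 0, 1, and a vector of type
  \<^typ>\<open>bool ^ 'n\<close> is an \<open>n\<close>-tuple of truth values, where \<open>n\<close> is the cardinality of the finite
  index type.  Since the arity \<open>k\<close> is quantified inside the notions below, a \<open>k\<close>-ary function is
  a function on lists of which only the values on lists of length \<open>k\<close> are ever constrained
  or inspected.
\<close>

type_synonym boolfun = "bool list \<Rightarrow> bool"

definition nondegenerate :: "(bool ^ 'n) set \<Rightarrow> bool" where
  "nondegenerate D \<longleftrightarrow> (\<forall>j. (\<lambda>x. x $ j) ` D = UNIV)"

definition unanimous :: "nat \<Rightarrow> boolfun \<Rightarrow> bool" where
  "unanimous k f \<longleftrightarrow> (\<forall>a. f (replicate k a) = a)"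

definition conservative :: "nat \<Rightarrow> boolfun \<Rightarrow> bool" where
  "conservative k f \<longleftrightarrow> (\<forall>as. length as = k \<longrightarrow> f as \<in> set as)"

definition apply_tuple :: "('n \<Rightarrow> boolfun) \<Rightarrow> (bool ^ 'n) list \<Rightarrow> bool ^ 'n" where
  "apply_tuple F xs = (\<chi> j. F j (map (\<lambda>x. x $ j) xs))"

definition aggregator :: "nat \<Rightarrow> (bool ^ 'n) set \<Rightarrow> ('n \<Rightarrow> boolfun) \<Rightarrow> bool" where
  "aggregator k D F \<longleftrightarrow>
     k \<ge> 2 \<and> (\<forall>j. unanimous k (F j)) \<and>
     (\<forall>xs. length xs = k \<and> set xs \<subseteq> D \<longrightarrow> apply_tuple F xs \<in> D)"

definition dictatorial :: "nat \<Rightarrow> ('n \<Rightarrow> boolfun) \<Rightarrow> bool" where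
  "dictatorial k F \<longleftrightarrow> (\<exists>d<k. \<forall>j as. length as = k \<longrightarrow> F j as = as ! d)"

definition possibility_domain :: "(bool ^ 'n) set \<Rightarrow> bool" where
  "possibility_domain D \<longleftrightarrow> (\<exists>k F. aggregator k D F \<and> \<not> dictatorial k F)"

definition generalized_dictatorship :: "nat \<Rightarrow> (bool ^ 'n) set \<Rightarrow> ('n \<Rightarrow> boolfun) \<Rightarrow> bool" where
  "generalized_dictatorship k D F \<longleftrightarrow>
     (\<forall>j. conservative k (F j)) \<and>
     (\<forall>xs. length xs = k \<and> set xs \<subseteq> D \<longrightarrow> apply_tuple F xs \<in> set xs)"

end

theory Submission
  imports Defs
begin

text \<open>
  Let every aggregator of \<open>D\<close> be a generalized dictatorship.  If the coordinatewise median of any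
  three elements of \<open>D\<close> were one of the three, take three distinct elements and let \<open>c\<close> be
  their median; then \<open>(u, v) \<mapsto> median u v c\<close> is an aggregator, and it sends the other two
  elements to \<open>c\<close>, so it is not a generalized dictatorship.  Hence some \<open>x, y, z \<in> D\<close> have a
  median outside \<open>{x, y, z}\<close>, so each of them is separated from the other two by a coordinate.
  Given an aggregator \<open>F\<close>, the sets of voters that enforce \<open>x\<close> on \<open>{x, y, z}\<close> then form an
  ultrafilter, as in Arrow's theorem, so the component of \<open>F\<close> at the coordinate separating \<open>x\<close> is
  a projection.  Since any two coordinates are separated simultaneously by one pair of elements
  of \<open>D\<close>, all components are that same projection.
\<close>

definition median :: "bool ^ 'n \<Rightarrow> bool ^ 'n \<Rightarrow> bool ^ 'n \<Rightarrow> bool ^ 'n" where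
  "median x y z = (\<chi> j. if x $ j = y $ j then x $ j else z $ j)"

lemma median_rotate: "median x y z = median y z x"
  by (auto simp: median_def vec_eq_iff)

text \<open>Read negatively, this supplies a coordinate at which \<open>x\<close> and
  \<open>y\<close> agree and \<open>z\<close> alone deviates.\<close>

lemma median_eq_third_iff: "median x y z = z \<longleftrightarrow> (\<forall>j. x $ j = y $ j \<longrightarrow> z $ j = x $ j)"
  by (auto simp: median_def vec_eq_iff)

lemma apply_tuple_nth [simp]: "apply_tuple F xs $ j = F j (map (\<lambda>x. x $ j) xs)"
  by (simp add: apply_tuple_def)

lemma dictatorial_imp_generalized_dictatorship:
  assumes "dictatorial k F"
  shows "generalized_dictatorship k D F"
proof -
  from assms obtain d where "d < k" and F: "\<And>j as. length as = k \<Longrightarrow> F j as = as ! d"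
    by (auto simp: dictatorial_def)
  have "apply_tuple F xs = xs ! d" if "length xs = k" for xs
    using that \<open>d < k\<close> by (simp add: vec_eq_iff F)
  then show ?thesis
    using F \<open>d < k\<close> by (simp add: generalized_dictatorship_def conservative_def)
qed

lemma ex_aggregator_not_generalized_dictatorship:
  fixes D :: "(bool ^ 'n) set"
  assumes median_in: "\<And>x y z. x \<in> D \<Longrightarrow> y \<in> D \<Longrightarrow> z \<in> D \<Longrightarrow> median x y z \<in> {x, y, z}"
    and "card D \<ge> 3"
  shows "\<exists>F. aggregator 2 D F \<and> \<not> generalized_dictatorship 2 D F"
proof -
  obtain T where "T \<subseteq> D" "card T = 3"
    using obtain_subset_with_card_n[OF \<open>card D \<ge> 3\<close>] by metis
  then obtain x y z where xyz: "x \<in> D" "y \<in> D" "z \<in> D" "x \<noteq> y" "x \<noteq> z" "y \<noteq> z"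
    by (auto simp: card_3_iff)
  \<comment> \<open>The median is invariant under rotation, so whichever element it equals can be
    moved to third place and renamed \<open>c\<close>.\<close>
  consider "median x y z = z" | "median y z x = x" | "median z x y = y"
    using median_in[OF xyz(1-3)] median_rotate[of x y z] median_rotate[of z x y] by auto
  then obtain a b c where abc: "a \<in> D" "b \<in> D" "c \<in> D" "median a b c = c" "c \<noteq> a" "c \<noteq> b"
    using xyz that by cases auto
  define F :: "'n \<Rightarrow> boolfun"
    where "F j as = (if as ! 0 = as ! 1 then as ! 0 else c $ j)" for j as
  have F: "apply_tuple F [u, v] = median u v c" for u v
    by (simp add: F_def median_def vec_eq_iff)
  have "aggregator 2 D F"
    unfolding aggregator_def
  proof (intro conjI allI impI)
    show "unanimous 2 (F j)" for j
      by (simp add: unanimous_def F_def numeral_2_eq_2)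
    fix xs :: "(bool ^ 'n) list"
    assume "length xs = 2 \<and> set xs \<subseteq> D"
    then obtain u v where "xs = [u, v]" "u \<in> D" "v \<in> D"
      by (auto simp: numeral_2_eq_2 length_Suc_conv)
    then show "apply_tuple F xs \<in> D"
      using median_in[of u v c] \<open>c \<in> D\<close> by (auto simp: F)
  qed simp
  moreover have "\<not> generalized_dictatorship 2 D F"
  proof
    assume "generalized_dictatorship 2 D F"
    then have "apply_tuple F [a, b] \<in> set [a, b]"
      using abc unfolding generalized_dictatorship_def
      by (elim conjE allE[of _ "[a, b]"]) simp
    then show False
      using abc by (simp add: F)
  qed
  ultimately show ?thesis by blast
qed

text \<open>
  Think of \<open>P\<close>, \<open>Q\<close>, \<open>R\<close> as the coalitions of voters enforcing each of three alternatives.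
\<close>

lemma winning_coalitions_principal:
  fixes P Q R :: "'a set \<Rightarrow> bool"
  assumes ex: "\<And>U V. U \<inter> V = {} \<Longrightarrow> P U \<or> Q V \<or> R (- (U \<union> V))"
    and PQ: "\<And>U V. U \<inter> V = {} \<Longrightarrow> \<not> (P U \<and> Q V)"
    and PR: "\<And>U V. U \<inter> V = {} \<Longrightarrow> \<not> (P U \<and> R (- (U \<union> V)))"
    and QR: "\<And>U V. U \<inter> V = {} \<Longrightarrow> \<not> (Q V \<and> R (- (U \<union> V)))"
    and empty: "\<not> P {}" "\<not> Q {}" "\<not> R {}"
    and "finite K" and restrict: "\<And>U. P U \<longleftrightarrow> P (U \<inter> K)"
  shows "\<exists>d\<in>K. \<forall>U. P U \<longleftrightarrow> d \<in> U"
proof -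
  \<comment> \<open>When \<open>U\<close> or \<open>V\<close> is empty, two complementary coalitions
    remain and exactly one of them wins. Hence \<open>P\<close> and \<open>Q\<close> are the same
    predicate.\<close>
  have P_compl: "P U \<longleftrightarrow> \<not> R (- U)" for U
    using ex[of U "{}"] PR[of U "{}"] empty by auto
  have Q_compl: "Q U \<longleftrightarrow> \<not> R (- U)" for U
    using ex[of "{}" U] QR[of "{}" U] empty by auto
  \<comment> \<open>Exactly one of \<open>P U\<close>, \<open>P V\<close> and
    \<open>R (- (U \<union> V))\<close> holds, and the last is the negation of
    \<open>P (U \<union> V)\<close>.\<close>
  have P_Un: "P (U \<union> V) \<longleftrightarrow> P U \<or> P V" if "U \<inter> V = {}" for U V
    using ex[OF that] PR[OF that] QR[OF that] P_compl Q_compl by metis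
  have P_disjoint: "\<not> (P U \<and> P V)" if "U \<inter> V = {}" for U V
    using PQ[OF that] P_compl Q_compl by metis
  \<comment> \<open>Additivity allows voters to be split off a finite winning coalition until a
    single one wins alone.\<close>
  have singleton: "\<exists>d\<in>A. P {d}" if "finite A" "P A" for A
    using that
  proof (induction A rule: finite_induct)
    case empty
    then show ?case using \<open>\<not> P {}\<close> by simp
  next
    case (insert a A)
    then show ?case using P_Un[of "{a}" A] by auto
  qed
  have "P K"
    using P_compl[of UNIV] empty restrict[of UNIV] by simp
  then obtain d where "d \<in> K" "P {d}"
    using singleton \<open>finite K\<close> by blast
  moreover have "P U \<longleftrightarrow> d \<in> U" for U
  proof (cases "d \<in> U")
    case True
    then have "{d} \<union> (U - {d}) = U" by auto
    then show ?thesis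
      using P_Un[of "{d}" "U - {d}"] \<open>P {d}\<close> True by auto
  next
    case False
    then show ?thesis using P_disjoint[of U "{d}"] \<open>P {d}\<close> by auto
  qed
  ultimately show ?thesis by blast
qed

text \<open>Coalitions are arbitrary sets of naturals, of which only the part below \<open>k\<close>
  counts; complements can thus be taken in the whole type.\<close>

definition enforces :: "nat \<Rightarrow> boolfun \<Rightarrow> bool \<Rightarrow> nat set \<Rightarrow> bool" where
  "enforces k f a U \<longleftrightarrow> f (map (\<lambda>m. if m \<in> U then a else \<not> a) [0..<k]) = a"

lemma not_enforces_empty: "unanimous k f \<Longrightarrow> \<not> enforces k f a {}"
  by (simp add: enforces_def unanimous_def map_replicate_const)

lemma enforces_restrict: "enforces k f a U \<longleftrightarrow> enforces k f a (U \<inter> {..<k})"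
proof -
  have "map (\<lambda>m. if m \<in> U then a else \<not> a) [0..<k]
      = map (\<lambda>m. if m \<in> U \<inter> {..<k} then a else \<not> a) [0..<k]"
    by (rule map_cong) auto
  then show ?thesis by (simp only: enforces_def)
qed

lemma projection_if_enforces:
  assumes "\<And>U. enforces k f a U \<longleftrightarrow> d \<in> U" "length as = k"
  shows "f as = as ! d"
proof -
  \<comment> \<open>\<open>as\<close> is the profile in which exactly \<open>U\<close> votes
    \<open>a\<close>. One value \<open>a\<close> suffices, since a boolean is determined by whether
    it equals \<open>a\<close>.\<close>
  define U where "U = {m. as ! m = a}"
  have "as = map (\<lambda>m. if m \<in> U then a else \<not> a) [0..<k]"
    using assms(2) by (intro nth_equalityI) (auto simp: U_def)
  then have "f as = a \<longleftrightarrow> d \<in> U"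
    using assms(1)[of U] by (simp add: enforces_def)
  then show ?thesis by (auto simp: U_def)
qed

lemma component_projection:
  fixes D :: "(bool ^ 'n) set"
  assumes una: "\<And>j. unanimous k (F j)"
    and sel: "\<And>xs. length xs = k \<Longrightarrow> set xs \<subseteq> D \<Longrightarrow> apply_tuple F xs \<in> set xs"
    and D: "x \<in> D" "y \<in> D" "z \<in> D"
    and i: "y $ i = z $ i" "x $ i \<noteq> y $ i"
    and j: "z $ j = x $ j" "y $ j \<noteq> z $ j"
    and l: "x $ l = y $ l" "z $ l \<noteq> x $ l"
  shows "\<exists>d<k. \<forall>as. length as = k \<longrightarrow> F i as = as ! d"
proof -
  define P Q R where "P = enforces k (F i) (x $ i)" and "Q = enforces k (F j) (y $ j)"
    and "R = enforces k (F l) (z $ l)"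
  have exactly_one: "(P U \<or> Q V \<or> R (- (U \<union> V))) \<and> \<not> (P U \<and> Q V) \<and>
      \<not> (P U \<and> R (- (U \<union> V))) \<and> \<not> (Q V \<and> R (- (U \<union> V)))"
    if "U \<inter> V = {}" for U V
  proof -
    \<comment> \<open>Coordinate \<open>i\<close> only tells \<open>x\<close> from the other two, so
      there the profile shows just \<open>U\<close> against the rest; likewise \<open>j\<close>
      shows \<open>V\<close>, and \<open>l\<close> the remaining voters. The outcome is one of
      \<open>x\<close>, \<open>y\<close>, \<open>z\<close>, so exactly one of these coalitions
      prevails.\<close>
    define xs where "xs = map (\<lambda>m. if m \<in> U then x else if m \<in> V then y else z) [0..<k]"
    have "apply_tuple F xs \<in> set xs"
      by (rule sel) (auto simp: xs_def D)
    also have "set xs \<subseteq> {x, y, z}" by (auto simp: xs_def)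
    finally have mem: "apply_tuple F xs \<in> {x, y, z}" .
    have "map (\<lambda>u. u $ i) xs = map (\<lambda>m. if m \<in> U then x $ i else \<not> x $ i) [0..<k]"
      using i by (auto simp: xs_def)
    then have P: "P U \<longleftrightarrow> apply_tuple F xs $ i = x $ i"
      by (simp add: P_def enforces_def)
    have "map (\<lambda>u. u $ j) xs = map (\<lambda>m. if m \<in> V then y $ j else \<not> y $ j) [0..<k]"
      using j that by (auto simp: xs_def)
    then have Q: "Q V \<longleftrightarrow> apply_tuple F xs $ j = y $ j"
      by (simp add: Q_def enforces_def)
    have "map (\<lambda>u. u $ l) xs
        = map (\<lambda>m. if m \<in> - (U \<union> V) then z $ l else \<not> z $ l) [0..<k]"
      using l by (auto simp: xs_def)
    then have R: "R (- (U \<union> V)) \<longleftrightarrow> apply_tuple F xs $ l = z $ l"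
      by (simp add: R_def enforces_def)
    show ?thesis
      unfolding P Q R using mem i j l by (auto simp del: apply_tuple_nth)
  qed
  have "\<exists>d\<in>{..<k}. \<forall>U. P U \<longleftrightarrow> d \<in> U"
  proof (rule winning_coalitions_principal[of P Q R])
    show "\<not> P {}" "\<not> Q {}" "\<not> R {}"
      by (simp_all add: P_def Q_def R_def not_enforces_empty una)
    show "P U \<longleftrightarrow> P (U \<inter> {..<k})" for U
      unfolding P_def by (rule enforces_restrict)
    show "finite {..<k}" by simp
  qed (use exactly_one in blast)+
  then obtain d where "d < k" and "\<And>U. enforces k (F i) (x $ i) U \<longleftrightarrow> d \<in> U"
    by (auto simp: P_def)
  then show ?thesis
    using projection_if_enforces[of k "F i" "x $ i" d] by auto
qed

lemma nondegenerate_separate_two: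
  assumes "nondegenerate D"
  obtains u v where "u \<in> D" "v \<in> D" "u $ i \<noteq> v $ i" "u $ q \<noteq> v $ q"
proof -
  have ex: "\<exists>u\<in>D. u $ j = b" for j b
    using assms unfolding nondegenerate_def by (metis UNIV_I imageE)
  obtain a b where ab: "a \<in> D" "b \<in> D" "a $ i" "\<not> b $ i"
    using ex[of i True] ex[of i False] by auto
  obtain z where z: "z \<in> D" "z $ q \<noteq> a $ q"
    using ex[of q "\<not> a $ q"] by auto
  \<comment> \<open>If \<open>a\<close> and \<open>b\<close> agree at \<open>q\<close>, then
    \<open>z\<close> differs from both there, and at \<open>i\<close> it differs from one of
    them.\<close>
  show thesis
    using that[of a b] that[of z a] that[of z b] ab z by metis
qed

text \<open>Any votes at \<open>q\<close> can be realized by a profile of copies of \<open>u\<close>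
  and \<open>v\<close>. The outcome is again \<open>u\<close> or \<open>v\<close>, and coordinate
  \<open>i\<close>, which tells them apart, identifies it as the choice of voter
  \<open>d\<close>.\<close>

lemma projection_transfer:
  assumes sel: "\<And>xs. length xs = k \<Longrightarrow> set xs \<subseteq> D \<Longrightarrow> apply_tuple F xs \<in> set xs"
    and "d < k" and proj: "\<And>as. length as = k \<Longrightarrow> F i as = as ! d"
    and uv: "u \<in> D" "v \<in> D" "u $ i \<noteq> v $ i" "u $ q \<noteq> v $ q"
    and "length as = k"
  shows "F q as = as ! d"
proof -
  define xs where "xs = map (\<lambda>a. if a = u $ q then u else v) as"
  have as: "map (\<lambda>x. x $ q) xs = as"
    using uv(4) by (auto simp: xs_def intro!: map_idI split: if_splits)
  have len: "length xs = k" and sub: "set xs \<subseteq> {u, v}"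
    using \<open>length as = k\<close> by (auto simp: xs_def)
  have "apply_tuple F xs \<in> {u, v}"
    using sel[OF len] sub uv(1,2) by blast
  moreover have "xs ! d \<in> {u, v}"
    using sub len \<open>d < k\<close> nth_mem by blast
  moreover have "apply_tuple F xs $ i = xs ! d $ i"
    using len \<open>d < k\<close> by (simp add: proj)
  ultimately have "apply_tuple F xs = xs ! d"
    using uv(3) by auto
  then have "F q (map (\<lambda>x. x $ q) xs) = xs ! d $ q"
    by (metis apply_tuple_nth)
  also have "\<dots> = map (\<lambda>x. x $ q) xs ! d"
    using len \<open>d < k\<close> by simp
  finally show ?thesis by (simp add: as)
qed

theorem theorem5p4:
  fixes D :: "(bool ^ 'n) set"
  assumes "nondegenerate D"
    and "card D \<ge> 3"
  shows "(\<exists>k F. aggregator k D F \<and> \<not> generalized_dictatorship k D F) \<longleftrightarrow> possibility_domain D"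
proof
  assume "\<exists>k F. aggregator k D F \<and> \<not> generalized_dictatorship k D F"
  then show "possibility_domain D"
    unfolding possibility_domain_def using dictatorial_imp_generalized_dictatorship by blast
next
  assume "possibility_domain D"
  then obtain k F where F: "aggregator k D F" "\<not> dictatorial k F"
    by (auto simp: possibility_domain_def)
  show "\<exists>k F. aggregator k D F \<and> \<not> generalized_dictatorship k D F"
  proof (rule ccontr)
    assume no: "\<nexists>k F. aggregator k D F \<and> \<not> generalized_dictatorship k D F"
    then obtain x y z where D: "x \<in> D" "y \<in> D" "z \<in> D" and "median x y z \<notin> {x, y, z}"
      using ex_aggregator_not_generalized_dictatorship[OF _ \<open>card D \<ge> 3\<close>] by blast
    then have "median x y z \<noteq> z" "median y z x \<noteq> x" "median z x y \<noteq> y"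
      using median_rotate[of x y z] median_rotate[of z x y] by auto
    \<comment> \<open>Each of the three rotated medians missing its third argument gives a
      coordinate isolating that argument.\<close>
    then obtain i j l where ijl: "y $ i = z $ i" "x $ i \<noteq> y $ i" "z $ j = x $ j" "y $ j \<noteq> z $ j"
        "x $ l = y $ l" "z $ l \<noteq> x $ l"
      unfolding median_eq_third_iff by blast
    have una: "\<And>j. unanimous k (F j)"
      using F(1) by (simp add: aggregator_def)
    have sel: "\<And>xs. length xs = k \<Longrightarrow> set xs \<subseteq> D \<Longrightarrow> apply_tuple F xs \<in> set xs"
      using F(1) no by (auto simp: generalized_dictatorship_def)
    obtain d where "d < k" and d: "\<And>as. length as = k \<Longrightarrow> F i as = as ! d"
      using component_projection[OF una sel D ijl] by blast
    have "F q as = as ! d" if "length as = k" for q as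
    proof -
      obtain u v where "u \<in> D" "v \<in> D" "u $ i \<noteq> v $ i" "u $ q \<noteq> v $ q"
        using nondegenerate_separate_two[OF assms(1)] .
      then show ?thesis
        using projection_transfer[of k D F d i u v q as] sel \<open>d < k\<close> d that by blast
    qed
    then show False
      using F(2) \<open>d < k\<close> by (auto simp: dictatorial_def)
  qed
qed

end
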